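(* For every integer $n\geq 1$, the middle layer graph $Q_{2n+1}(n,n+1)$ has a Hamilton cycle.
   Context: For $m\geq 1$ and $0\leq k\leq m$, let $B_m(k)$ denote the set of bitstrings of length $m$ with exactly $k$ entries equal to $1$. The middle layer graph $Q_{2n+1}(n,n+1)$ is the graph with vertex set $B_{2n+1}(n)\cup B_{2n+1}(n+1)$, in which two vertices are adjacent if and only if the corresponding bitstrings differ in exactly one bit. *)

theory Defs
  imports "Graph_Theory.Graph_Theory"
begin

text \<open>
  Bitstrings are boolean lists, the entry \<open>1\<close> being \<^const>\<open>True\<close>.
\<close>

definition bitstrings :: "nat \<Rightarrow> nat \<Rightarrow> bool list set" where
  "bitstrings m k = {x. length x = m \<and> card {i. i < m \<and> x ! i} = k}"

text \<open>
  An undirected graph is modelled as a symmetric digraph, as in \<^locale>\<open>pair_graph\<close>: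
  each edge is represented by its two orientations.
\<close>

definition middle_layer_graph :: "nat \<Rightarrow> bool list pair_pre_digraph" where
  "middle_layer_graph n =
    (let V = bitstrings (2 * n + 1) n \<union> bitstrings (2 * n + 1) (n + 1)
     in \<lparr> pverts = V,
          parcs = {(x, y). x \<in> V \<and> y \<in> V \<and> card {i. i < 2 * n + 1 \<and> x ! i \<noteq> y ! i} = 1} \<rparr>)"

text \<open>
  In a symmetric digraph the closed walk \<open>a, b, a\<close> satisfies \<^const>\<open>pre_digraph.cycle\<close>
  although it is not a cycle of the underlying undirected graph. The length bound
  excludes it.
\<close>

definition (in pre_digraph) hamilton_cycle :: "'b awalk \<Rightarrow> bool" where
  "hamilton_cycle p \<longleftrightarrow> cycle p \<and> 3 \<le> length p \<and> tail G ` set p = verts G"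

lemma pair_graph_middle_layer_graph: "pair_graph (middle_layer_graph n)"
proof -
  have "finite (bitstrings m k)" for m k
    by (rule finite_subset[OF _ finite_lists_length_eq[OF finite_UNIV, of m]])
       (auto simp: bitstrings_def)
  then have fin: "finite (pverts (middle_layer_graph n))"
    by (simp add: middle_layer_graph_def Let_def)
  have sub: "parcs (middle_layer_graph n)
      \<subseteq> pverts (middle_layer_graph n) \<times> pverts (middle_layer_graph n)"
    by (auto simp: middle_layer_graph_def Let_def)
  have symm: "(y, x) \<in> parcs (middle_layer_graph n)"
    if "(x, y) \<in> parcs (middle_layer_graph n)" for x y
  proof -
    have "{i. i < 2 * n + 1 \<and> x ! i \<noteq> y ! i} = {i. i < 2 * n + 1 \<and> y ! i \<noteq> x ! i}"
      by blast
    then show ?thesis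
      using that by (simp add: middle_layer_graph_def Let_def)
  qed
  have irr: "(x, x) \<notin> parcs (middle_layer_graph n)" for x
    by (simp add: middle_layer_graph_def Let_def)
  show ?thesis
  proof
    show "finite (parcs (middle_layer_graph n))"
      using finite_subset[OF sub] fin by simp
    show "symmetric (with_proj (middle_layer_graph n))"
      using symm by (auto simp: symmetric_def intro!: symI)
    show "fst e \<noteq> snd e" if "e \<in> parcs (middle_layer_graph n)" for e
      using that irr by (cases e) auto
  qed (use fin sub in auto)
qed

end

theory Submission
  imports Defs
begin

text \<open>
  We follow the idea of Muetze's ``book proof''. Every bitstring of length \<open>2n + 1\<close> with
  \<open>n\<close> (respectively \<open>n + 1\<close>) ones is in a unique way a cyclic rotation of a Dyck word followed
  by \<open>0\<close> (respectively \<open>1\<close>). Writing a Dyck word as \<open>1 a 0 b\<close>, the flips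
  \<open>1 a 0 b 0 \<rightarrow> 1 a 1 b 0 \<rightarrow> 0 a 1 b 0\<close> lead to the rotated word \<open>a 1 b 0\<close>, followed by \<open>0\<close>
  and shifted by one position. Iterating them partitions the graph into cycles, one for each orbit
  of the rotation \<open>1 a 0 b \<mapsto> a 1 b 0\<close>, that is, for each plane tree with \<open>n\<close> edges.

  For \<open>x = 1 1 0 u 0 v\<close> and \<open>y = 1 0 1 u 0 v\<close>, a 6-cycle shares the edges
  \<open>x\<^sub>0 x\<^sub>1\<close> and \<open>x\<^sub>5 x\<^sub>6\<close> with the cycle \<open>x\<^sub>0, x\<^sub>1, \<dots>\<close> of \<open>x\<close> and the edge \<open>y\<^sub>0 y\<^sub>1\<close> with that of \<open>y\<close>;
  replacing \<open>y\<^sub>0 y\<^sub>1\<close> by the path \<open>y\<^sub>0, x\<^sub>5, x\<^sub>4, \<dots>, x\<^sub>1, x\<^sub>6, x\<^sub>7, \<dots>, x\<^sub>0, y\<^sub>1\<close> merges the two cycles.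
  Starting with the cycle of the star, all others are merged in one after the other: pulling a
  leaf towards the root of a word of least area among those not yet covered yields a word of smaller
  area, and the two words are rotations of such a pair \<open>x\<close>, \<open>y\<close>.
\<close>

section \<open>Lists as paths\<close>

fun steps :: "'a list \<Rightarrow> ('a \<times> 'a) list" where
  "steps (x # y # xs) = (x, y) # steps (y # xs)"
| "steps _ = []"

lemma steps_append:
  "set (steps (xs @ y # ys)) = set (steps (xs @ [y])) \<union> set (steps (y # ys))"
  by (induction xs rule: steps.induct) auto

lemma steps_append_Cons:
  "set (steps (xs @ x # y # ys)) = insert (x, y) (set (steps (xs @ [x])) \<union> set (steps (y # ys)))"
  by (subst steps_append) auto

lemma steps_join:
  assumes "xs \<noteq> []" "ys \<noteq> []"
  shows "set (steps (xs @ ys)) = insert (last xs, hd ys) (set (steps xs) \<union> set (steps ys))"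
proof -
  obtain as a where "xs = as @ [a]" using assms(1) by (cases xs rule: rev_cases) auto
  moreover obtain b bs where "ys = b # bs" using assms(2) by (cases ys) auto
  ultimately show ?thesis by (simp add: steps_append_Cons)
qed

lemma steps_rev: "set (steps (rev xs)) = (set (steps xs))\<inverse>"
proof (induction xs rule: steps.induct)
  case (1 x y xs)
  have "set (steps (rev (x # y # xs))) = set (steps (rev xs @ [y])) \<union> {(y, x)}"
    using steps_append[of "rev xs" y "[x]"] by simp
  then show ?case using 1 by auto
qed auto

lemma steps_split: "(x, y) \<in> set (steps zs) \<Longrightarrow> \<exists>us vs. zs = us @ x # y # vs"
proof (induction zs rule: steps.induct)
  case (1 a b zs)
  then show ?case
  proof (cases "(x, y) = (a, b)")
    case False
    with 1 obtain us vs where "b # zs = us @ x # y # vs" by auto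
    then have "a # b # zs = (a # us) @ x # y # vs" by simp
    then show ?thesis by blast
  qed (metis append_Nil prod.inject)
qed auto

lemma steps_map_upt:
  "set (steps (map f [i..<j])) = (\<lambda>k. (f k, f (Suc k))) ` {k. i \<le> k \<and> Suc k < j}"
proof (induction "j - i" arbitrary: i)
  case (Suc d)
  show ?case
  proof (cases "Suc i < j")
    case True
    then have "map f [i..<j] = f i # map f [Suc i..<j]" "map f [Suc i..<j] = f (Suc i) # map f [Suc (Suc i)..<j]"
      by (simp_all add: upt_conv_Cons)
    then have "set (steps (map f [i..<j])) = insert (f i, f (Suc i)) (set (steps (map f [Suc i..<j])))"
      by simp
    moreover have "{k. i \<le> k \<and> Suc k < j} = insert i {k. Suc i \<le> k \<and> Suc k < j}"
      using True by auto
    ultimately show ?thesis using Suc(1)[of "Suc i"] Suc(2) by simp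
  next
    case False
    with Suc(2) have "j = Suc i" by simp
    then show ?thesis by auto
  qed
qed auto

lemma steps_subset: "set (steps xs) \<subseteq> set xs \<times> set xs"
  by (induction xs rule: steps.induct) auto

lemma map_fst_steps: "map fst (steps xs) = butlast xs"
  by (induction xs rule: steps.induct) auto

lemma awalk_verts_steps:
  "pre_digraph.awalk_verts (with_proj G) u (steps (u # xs)) = u # xs"
  by (induction xs arbitrary: u) (auto simp: pre_digraph.awalk_verts.simps)

lemma cas_steps: "pre_digraph.cas (with_proj G) u (steps (u # xs)) (last (u # xs))"
  by (induction xs arbitrary: u) (auto simp: pre_digraph.cas.simps)

lemma hamilton_cycle_steps:
  assumes "distinct xs" "set xs = pverts G" "set (steps xs) \<subseteq> parcs G"
    "(last xs, hd xs) \<in> parcs G" "3 \<le> length xs"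
  shows "pre_digraph.hamilton_cycle (with_proj G) (steps (xs @ [hd xs]))"
proof -
  obtain x ys where xs: "xs = x # ys" "ys \<noteq> []" using assms(5) by (cases xs) force+
  define p where "p = steps (xs @ [x])"
  have p: "p = steps (x # (ys @ [x]))" by (simp add: p_def xs)
  have verts: "pre_digraph.awalk_verts (with_proj G) x p = x # ys @ [x]"
    unfolding p by (rule awalk_verts_steps)
  have "set p \<subseteq> parcs G"
  proof -
    have "xs @ [x] = butlast xs @ last xs # x # []" using xs by simp
    then have "set p = insert (last xs, x) (set (steps (butlast xs @ [last xs])))"
      unfolding p_def by (simp only: steps_append_Cons) simp
    then show ?thesis using assms(3,4) xs by simp
  qed
  moreover have "pre_digraph.cas (with_proj G) x p x"
    using cas_steps[of G x "ys @ [x]"] by (simp add: p)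
  ultimately have "pre_digraph.awalk (with_proj G) x p x"
    using assms(2) xs by (auto simp: pre_digraph.awalk_def)
  \<comment> \<open>\<open>cycle\<close> drops the first vertex of the closed walk, so
    \<open>x\<close> is counted only at its end.\<close>
  moreover have "distinct (ys @ [x])" using assms(1) xs by auto
  moreover have "p \<noteq> []" using xs by (cases ys) (auto simp: p)
  ultimately have "pre_digraph.cycle (with_proj G) p"
    using verts unfolding pre_digraph.cycle_def by auto
  moreover have m: "map fst p = xs" by (simp add: p_def map_fst_steps)
  moreover from m have "length p = length xs" by (metis length_map)
  moreover from m have "fst ` set p = set xs" by (metis set_map)
  ultimately show ?thesis
    using assms(2,5) by (simp add: pre_digraph.hamilton_cycle_def p_def xs)
qed

section \<open>Splicing one path into another\<close>

definition links :: "'a list \<Rightarrow> ('a \<times> 'a) set" where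
  "links xs = set (steps xs) \<union> (set (steps xs))\<inverse>"

lemma links_rev [simp]: "links (rev xs) = links xs"
  by (simp add: links_def steps_rev Un_commute)

text \<open>Inserting \<open>ps\<close> between the neighbours \<open>a\<close> and \<open>b\<close>
  loses only the edge joining them, and the ends of \<open>xs\<close> stay, so a closing edge
  survives.\<close>

lemma splice_directed:
  assumes "(a, b) \<in> set (steps xs)" "distinct xs" "distinct ps" "set xs \<inter> set ps = {}" "ps \<noteq> []"
    and "links xs \<union> links ps \<subseteq> R" "sym R" "(a, hd ps) \<in> R" "(last ps, b) \<in> R"
  shows "\<exists>ys. distinct ys \<and> set ys = set xs \<union> set ps \<and> hd ys = hd xs \<and> last ys = last xs \<and>
    links ys \<subseteq> R \<and> links xs - {(a, b), (b, a)} \<union> links ps \<subseteq> links ys"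
proof -
  obtain us vs where xs: "xs = us @ a # b # vs" using steps_split[OF assms(1)] by blast
  define ys where "ys = us @ a # ps @ b # vs"
  have "set (steps ys) = insert (a, hd ps) (set (steps (us @ [a])) \<union> set (steps (ps @ b # vs)))"
    using steps_join[of "us @ [a]" "ps @ b # vs"] assms(5) by (simp add: ys_def)
  moreover have "set (steps (ps @ b # vs)) = insert (last ps, b) (set (steps ps) \<union> set (steps (b # vs)))"
    using steps_join[OF assms(5), of "b # vs"] by simp
  ultimately have ys: "set (steps ys) = {(a, hd ps), (last ps, b)} \<union> set (steps (us @ [a]))
      \<union> set (steps ps) \<union> set (steps (b # vs))"
    by auto
  have sx: "set (steps xs) = insert (a, b) (set (steps (us @ [a])) \<union> set (steps (b # vs)))"
    unfolding xs by (rule steps_append_Cons)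
  have "links ys \<subseteq> R" "links xs - {(a, b), (b, a)} \<union> links ps \<subseteq> links ys"
    using assms(6,8,9) symD[OF assms(7) assms(8)] symD[OF assms(7) assms(9)]
    unfolding links_def ys sx by auto
  moreover have "distinct ys" "set ys = set xs \<union> set ps" "hd ys = hd xs" "last ys = last xs"
    using assms(2-5) by (auto simp: xs ys_def hd_append)
  ultimately show ?thesis by (intro exI[of _ ys] conjI)
qed

lemma splice:
  assumes "(a, b) \<in> links xs" "distinct xs" "distinct ps" "set xs \<inter> set ps = {}" "ps \<noteq> []"
    and "links xs \<union> links ps \<subseteq> R" "sym R" "(a, hd ps) \<in> R" "(last ps, b) \<in> R"
  shows "\<exists>ys. distinct ys \<and> set ys = set xs \<union> set ps \<and> hd ys = hd xs \<and> last ys = last xs \<and>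
    links ys \<subseteq> R \<and> links xs - {(a, b), (b, a)} \<union> links ps \<subseteq> links ys"
proof (cases "(a, b) \<in> set (steps xs)")
  case True
  from splice_directed[OF this assms(2-)] show ?thesis .
next
  case False
  \<comment> \<open>When \<open>xs\<close> runs through the edge backwards, \<open>ps\<close> is
    reversed instead of \<open>xs\<close>, which keeps the ends of \<open>xs\<close>.\<close>
  with assms(1) have ba: "(b, a) \<in> set (steps xs)" by (auto simp: links_def)
  have "(b, hd (rev ps)) \<in> R" "(last (rev ps), a) \<in> R"
    using symD[OF assms(7) assms(8)] symD[OF assms(7) assms(9)] by (simp_all add: hd_rev last_rev)
  moreover have "distinct (rev ps)" "set xs \<inter> set (rev ps) = {}" "rev ps \<noteq> []" "links xs \<union> links (rev ps) \<subseteq> R"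
    using assms(3-6) by simp_all
  ultimately have "\<exists>ys. distinct ys \<and> set ys = set xs \<union> set (rev ps) \<and> hd ys = hd xs \<and> last ys = last xs \<and>
    links ys \<subseteq> R \<and> links xs - {(b, a), (a, b)} \<union> links (rev ps) \<subseteq> links ys"
    by (intro splice_directed[OF ba assms(2) _ _ _ _ assms(7)])
  moreover have "{(b, a), (a, b)} = {(a, b), (b, a)}" by (rule insert_commute)
  ultimately show ?thesis by (simp only: links_rev set_rev)
qed

section \<open>Bit flips\<close>

definition flip :: "bool list \<Rightarrow> bool list \<Rightarrow> bool" where
  "flip x y \<longleftrightarrow> (\<exists>p q c. x = p @ c # q \<and> y = p @ (\<not> c) # q)"

lemma flipI: "d = (\<not> c) \<Longrightarrow> flip (p @ c # q) (p @ d # q)"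
  by (auto simp: flip_def)

lemma flip_sym: "flip x y \<Longrightarrow> flip y x"
proof -
  assume "flip x y"
  then obtain p q c where "x = p @ c # q" "y = p @ (\<not> c) # q" by (auto simp: flip_def)
  then show "flip y x" using flipI[of c "\<not> c" p q] by simp
qed

lemma flip_rotate1: "flip x y \<Longrightarrow> flip (rotate1 x) (rotate1 y)"
proof -
  assume "flip x y"
  then obtain p q c where xy: "x = p @ c # q" "y = p @ (\<not> c) # q" by (auto simp: flip_def)
  show ?thesis
  proof (cases p)
    case Nil
    then show ?thesis using xy flipI[of "\<not> c" c q "[]"] by simp
  next
    case (Cons a p')
    then show ?thesis using xy flipI[of "\<not> c" c p' "q @ [a]"] by simp
  qed
qed

lemma flip_rotate: "flip x y \<Longrightarrow> flip (rotate k x) (rotate k y)"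
  by (induction k) (auto simp: flip_rotate1)

lemma flip_card:
  assumes "flip x y"
  shows "length x = length y" "card {i. i < length x \<and> x ! i \<noteq> y ! i} = 1"
proof -
  obtain p q c where xy: "x = p @ c # q" "y = p @ (\<not> c) # q"
    using assms by (auto simp: flip_def)
  then have "{i. i < length x \<and> x ! i \<noteq> y ! i} = {length p}"
    by (auto simp: nth_append nth_Cons' split: if_splits)
  then show "card {i. i < length x \<and> x ! i \<noteq> y ! i} = 1" "length x = length y"
    using xy by auto
qed

section \<open>Dyck words and their rotation\<close>

text \<open>Splitting a Dyck word at its first return to height 0 is unique, so the words form a
  free datatype; \<open>size\<close> is the number of ones.\<close>

datatype dyck = Eps | Arch dyck dyck

fun word :: "dyck \<Rightarrow> bool list" where
  "word Eps = []"
| "word (Arch a b) = True # word a @ False # word b"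

fun cat :: "dyck \<Rightarrow> dyck \<Rightarrow> dyck" where
  "cat Eps t = t"
| "cat (Arch a b) t = Arch a (cat b t)"

text \<open>On plane trees this moves the root along its first edge.\<close>

fun rot :: "dyck \<Rightarrow> dyck" where
  "rot Eps = Eps"
| "rot (Arch a b) = cat a (Arch b Eps)"

text \<open>
  The word is the contour walk of a plane tree; the area is the sum of the depths of its edges.
\<close>

fun area :: "dyck \<Rightarrow> nat" where
  "area Eps = 0"
| "area (Arch a b) = area a + size a + area b"

text \<open>The star rooted at its centre, the only word of its size with area 0: here the pulling
  of leaves stops.\<close>

fun star :: "nat \<Rightarrow> dyck" where
  "star 0 = Eps"
| "star (Suc n) = Arch Eps (star n)"

definition ones :: "bool list \<Rightarrow> nat" where
  "ones xs = length (filter id xs)"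

lemma ones_simps [simp]:
  "ones [] = 0" "ones (True # xs) = Suc (ones xs)" "ones (False # xs) = ones xs"
  "ones (xs @ ys) = ones xs + ones ys"
  by (auto simp: ones_def)

lemma length_word [simp]: "length (word t) = 2 * size t"
  by (induction t) auto

lemma ones_word [simp]: "ones (word t) = size t"
  by (induction t) auto

lemma word_cat [simp]: "word (cat s t) = word s @ word t"
  by (induction s) auto

lemma cat_assoc [simp]: "cat (cat r s) t = cat r (cat s t)"
  by (induction r) auto

lemma cat_Eps [simp]: "cat t Eps = t"
  by (induction t) auto

lemma size_cat [simp]: "size (cat s t) = size s + size t"
  by (induction s) auto

lemma size_rot [simp]: "size (rot t) = size t"
  by (cases t) auto

lemma size_rot_pow [simp]: "size ((rot ^^ k) t) = size t"
  by (induction k) auto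

lemma size_star [simp]: "size (star n) = n"
  by (induction n) auto

text \<open>The \<open>False\<close> after a Dyck word is the first entry at which the path drops
  below its start, so it marks the end of the word. With this terminator the induction hypothesis
  applies to \<open>a\<close>, which is closed by a \<open>False\<close>.\<close>

lemma word_append_False_inject:
  "word s @ False # xs = word t @ False # ys \<Longrightarrow> s = t \<and> xs = ys"
proof (induction s arbitrary: t xs ys)
  case Eps
  then show ?case by (cases t) auto
next
  case (Arch a b)
  from Arch(3) obtain a' b' where t: "t = Arch a' b'" by (cases t) auto
  with Arch(3) have "word a @ False # (word b @ False # xs) = word a' @ False # (word b' @ False # ys)"
    by simp
  then have a: "a = a' \<and> word b @ False # xs = word b' @ False # ys" by (rule Arch(1))
  then have "b = b' \<and> xs = ys" by (intro Arch(2)) simp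
  then show ?case using a t by simp
qed

lemma word_inject: "word s = word t \<Longrightarrow> s = t"
  using word_append_False_inject[of s "[]" t "[]"] by simp

text \<open>The root walks around \<open>d\<close>. For an arch, one rotation enters
  \<open>a\<close>, the hypothesis for \<open>a\<close> leads around it, one rotation leaves it, and
  the hypothesis for \<open>b\<close> does the rest.\<close>

lemma rot_pow_cat: "(rot ^^ (2 * size d)) (cat d t) = cat t d"
proof (induction d arbitrary: t)
  case (Arch a b)
  have "2 * size (Arch a b) = 2 * size b + (1 + (2 * size a + 1))" by simp
  then have "(rot ^^ (2 * size (Arch a b))) (cat (Arch a b) t)
    = (rot ^^ (2 * size b)) (rot ((rot ^^ (2 * size a)) (cat a (Arch (cat b t) Eps))))"
    by (simp only: funpow_add) simp
  also have "\<dots> = (rot ^^ (2 * size b)) (cat b (cat t (Arch a Eps)))"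
    by (simp add: Arch.IH(1))
  also have "\<dots> = cat t (Arch a b)"
    by (simp only: Arch.IH(2)) simp
  finally show ?case .
qed simp

lemma rot_pow_size: "(rot ^^ (2 * size t)) t = t"
  using rot_pow_cat[of t Eps] by simp

lemma rot_pow_multiple: "(rot ^^ (2 * size t * m)) t = t"
  by (induction m) (auto simp: funpow_add rot_pow_size)

text \<open>A full walk of \<open>2 * size t\<close> rotations fixes \<open>t\<close>; taking
  \<open>i\<close> of them leaves room to subtract \<open>i\<close>. For \<open>Eps\<close> the
  subtraction truncates, but \<open>rot\<close> fixes \<open>Eps\<close>.\<close>

lemma rot_pow_inverse: "(rot ^^ (2 * size t * i - i)) ((rot ^^ i) t) = t"
proof (cases "size t = 0")
  case True
  then have "t = Eps" by (cases t) auto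
  moreover have "(rot ^^ i) Eps = Eps" by (induction i) auto
  ultimately show ?thesis by simp
next
  case False
  then have "i \<le> 2 * size t * i" by simp
  then have "(rot ^^ (2 * size t * i - i)) ((rot ^^ i) t) = (rot ^^ (2 * size t * i)) t"
    by (metis funpow_add le_add_diff_inverse2 o_apply)
  then show ?thesis by (simp only: rot_pow_multiple)
qed

lemma rot_pow_cancel:
  assumes "(rot ^^ i) s = (rot ^^ i) t"
  shows "s = t"
proof -
  have "size s = size t" using arg_cong[OF assms, of size] by simp
  then have "s = (rot ^^ (2 * size t * i - i)) ((rot ^^ i) s)" by (simp only: rot_pow_inverse flip: \<open>size s = size t\<close>)
  then show ?thesis by (simp only: assms rot_pow_inverse)
qed

text \<open>
  The context \<open>e\<close> makes the induction work: rotating \<open>1 a 0 b e\<close> brings \<open>a\<close> (and later \<open>b\<close>) to the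
  front, with the remainder of the word as new context.
\<close>

lemma pull_leaf:
  "t = star (size t) \<or> (\<exists>t'. size t' = size t \<and> area t' < area t \<and>
     (\<forall>e. \<exists>u v i j. (rot ^^ i) (cat t e) = Arch (Arch Eps u) v \<and>
       (rot ^^ j) (cat t' e) = Arch Eps (Arch u v)))"
proof (induction t)
  case (Arch a b)
  \<comment> \<open>Unless the tree is a star, a leaf is pulled inside \<open>b\<close> when
    \<open>a\<close> is empty, and inside \<open>a\<close> when \<open>a\<close> is not a star. If
    \<open>a\<close> starts with a leaf, as every nonempty star does, that leaf moves up to the
    root.\<close>
  consider "a = Eps" "b = star (size b)"
    | "a = Eps" "b \<noteq> star (size b)"
    | c where "a = Arch Eps c"
    | "a \<noteq> Eps" "a \<noteq> star (size a)"
  proof (cases "size a")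
    case 0
    then have "a = Eps" by (cases a) auto
    then show ?thesis using that(1,2) by blast
  next
    case (Suc m)
    show ?thesis
    proof (cases "a = star (size a)")
      case True
      with Suc have "a = star (Suc m)" by (rule subst)
      then show ?thesis using that(3) by simp
    next
      case False
      moreover from Suc have "a \<noteq> Eps" by auto
      ultimately show ?thesis using that(4) by blast
    qed
  qed
  then show ?case
  proof cases
    case 1
    then have "Arch a b = star (Suc (size b))" by simp
    then show ?thesis using 1 by simp
  next
    case 2
    with Arch(2) obtain b' where b': "size b' = size b" "area b' < area b"
      and ex: "\<And>e. \<exists>u v i j. (rot ^^ i) (cat b e) = Arch (Arch Eps u) v \<and>
       (rot ^^ j) (cat b' e) = Arch Eps (Arch u v)" by blast
    have "\<exists>u v i j. (rot ^^ i) (cat (Arch a b) e) = Arch (Arch Eps u) v \<and>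
       (rot ^^ j) (cat (Arch Eps b') e) = Arch Eps (Arch u v)" for e
    proof -
      \<comment> \<open>Two rotations carry the leading leaf edge behind \<open>e\<close> and leave
        \<open>b\<close> in front.\<close>
      obtain u v i j where *: "(rot ^^ i) (cat b (cat e (Arch Eps Eps))) = Arch (Arch Eps u) v"
        "(rot ^^ j) (cat b' (cat e (Arch Eps Eps))) = Arch Eps (Arch u v)" using ex by blast
      then have "(rot ^^ (i + 2)) (cat (Arch a b) e) = Arch (Arch Eps u) v"
        "(rot ^^ (j + 2)) (cat (Arch Eps b') e) = Arch Eps (Arch u v)"
        using 2 by (simp_all only: funpow_add) (simp_all add: numeral_2_eq_2)
      then show ?thesis by blast
    qed
    then show ?thesis using 2 b' by (intro disjI2 exI[of _ "Arch Eps b'"]) auto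
  next
    case 3
    have "\<exists>u v i j. (rot ^^ i) (cat (Arch a b) e) = Arch (Arch Eps u) v \<and>
       (rot ^^ j) (cat (Arch Eps (Arch c b)) e) = Arch Eps (Arch u v)" for e
      using 3 by (intro exI[of _ c] exI[of _ "cat b e"] exI[of _ 0]) simp
    then show ?thesis using 3 by (intro disjI2 exI[of _ "Arch Eps (Arch c b)"]) simp
  next
    case 4
    with Arch(1) obtain a' where a': "size a' = size a" "area a' < area a"
      and ex: "\<And>e. \<exists>u v i j. (rot ^^ i) (cat a e) = Arch (Arch Eps u) v \<and>
       (rot ^^ j) (cat a' e) = Arch Eps (Arch u v)" by blast
    have "\<exists>u v i j. (rot ^^ i) (cat (Arch a b) e) = Arch (Arch Eps u) v \<and>
       (rot ^^ j) (cat (Arch a' b) e) = Arch Eps (Arch u v)" for e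
    proof -
      obtain u v i j where *: "(rot ^^ i) (cat a (Arch (cat b e) Eps)) = Arch (Arch Eps u) v"
        "(rot ^^ j) (cat a' (Arch (cat b e) Eps)) = Arch Eps (Arch u v)" using ex by blast
      then have "(rot ^^ (i + 1)) (cat (Arch a b) e) = Arch (Arch Eps u) v"
        "(rot ^^ (j + 1)) (cat (Arch a' b) e) = Arch Eps (Arch u v)"
        by (simp_all only: funpow_add) simp_all
      then show ?thesis by blast
    qed
    then show ?thesis using a' by (intro disjI2 exI[of _ "Arch a' b"]) auto
  qed
qed simp

section \<open>Bitstrings as rotated Dyck words\<close>

lemma ones_prefix:
  "word t = xs @ ys \<Longrightarrow> length xs \<le> 2 * ones xs"
proof (induction t arbitrary: xs ys)
  case (Arch a b)
  show ?case
  proof (cases xs)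
    case (Cons x xs')
    with Arch(3) have x: "x" and eq: "word a @ False # word b = xs' @ ys" by auto
    from eq consider us where "word a = xs' @ us"
      | us where "xs' = word a @ us" "False # word b = us @ ys"
      by (auto simp: append_eq_append_conv2)
    then show ?thesis
    proof cases
      case 1
      from Arch(1)[OF this] show ?thesis using Cons x by simp
    next
      case (2 us)
      show ?thesis
      proof (cases us)
        case (Cons z us')
        with 2 have "word b = us' @ ys" "\<not> z" by auto
        with Arch(2) 2 Cons show ?thesis using \<open>xs = x # xs'\<close> x by fastforce
      qed (use Cons x 2 in auto)
    qed
  qed auto
qed simp

text \<open>A leaf can be attached at any point of the contour walk. This restores the factor
  removed in the induction of \<open>rotation_of_word\<close>.\<close>

lemma word_insert:
  "word t = xs @ ys \<Longrightarrow> \<exists>t'. word t' = xs @ [True, False] @ ys"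
proof (induction t arbitrary: xs ys)
  case Eps
  then have "word (Arch Eps Eps) = xs @ [True, False] @ ys" by simp
  then show ?case by blast
next
  case (Arch a b)
  show ?case
  proof (cases xs)
    case Nil
    with Arch(3) have "word (Arch Eps (Arch a b)) = xs @ [True, False] @ ys" by simp
    then show ?thesis by blast
  next
    case (Cons x xs')
    with Arch(3) have x: "x" and eq: "word a @ False # word b = xs' @ ys" by auto
    from eq consider us where "word a = xs' @ us" "ys = us @ False # word b"
      | us where "xs' = word a @ False # us" "word b = us @ ys"
      by (auto simp: append_eq_append_conv2 Cons_eq_append_conv)
    then show ?thesis
    proof cases
      case 1
      with Arch(1) obtain a' where "word a' = xs' @ [True, False] @ us" by blast
      then have "word (Arch a' b) = xs @ [True, False] @ ys" using 1 Cons x by simp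
      then show ?thesis by blast
    next
      case 2
      with Arch(2) obtain b' where "word b' = us @ [True, False] @ ys" by blast
      then have "word (Arch a b') = xs @ [True, False] @ ys" using 2 Cons x by simp
      then show ?thesis by blast
    qed
  qed
qed

lemma ones_Cons: "ones (b # xs) = of_bool b + ones xs"
  by (cases b) auto

lemma ones_rotate [simp]: "ones (rotate k xs) = ones xs"
proof (induction k)
  case (Suc k)
  have "ones (rotate1 ys) = ones ys" for ys by (cases ys) (auto simp: ones_Cons)
  then show ?case using Suc by simp
qed simp

lemma ones_card: "ones xs = card {i. i < length xs \<and> xs ! i}"
  by (simp add: ones_def length_filter_conv_card)

lemma rotation_insert:
  assumes "xs @ ys = rotate k (word t @ [c])"
  shows "\<exists>t' j. xs @ [True, False] @ ys = rotate j (word t' @ [c])"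
proof -
  define zs where "zs = word t @ [c]"
  \<comment> \<open>The cut between \<open>xs\<close> and \<open>ys\<close> as a position in
    \<open>zs\<close>. Reducing modulo the length counts a cut after \<open>c\<close> as one before
    \<open>word t\<close>, so it never lies behind \<open>c\<close>.\<close>
  define m where "m = (k + length xs) mod length zs"
  have m: "m \<le> length (word t)" unfolding m_def zs_def by (simp add: less_Suc_eq_le flip: less_Suc_eq_le)
  have "ys @ xs = rotate (length xs) (xs @ ys)" by (simp add: rotate_append)
  also have "\<dots> = rotate (k + length xs) zs"
    by (simp add: assms zs_def rotate_rotate add.commute)
  also have "\<dots> = drop m zs @ take m zs" by (simp add: rotate_drop_take m_def)
  finally have yx: "ys @ xs = drop m (word t) @ [c] @ take m (word t)" using m by (simp add: zs_def)
  obtain t' where t': "word t' = take m (word t) @ [True, False] @ drop m (word t)"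
    using word_insert[of t "take m (word t)" "drop m (word t)"] by auto
  have "xs @ [True, False] @ ys = rotate (length ys) (ys @ xs @ [True, False])"
    using rotate_append[of ys "xs @ [True, False]"] by simp
  also have "ys @ xs @ [True, False] = (drop m (word t) @ [c]) @ (take m (word t) @ [True, False])"
    using yx by simp
  also have "\<dots> = rotate (length (take m (word t) @ [True, False])) (word t' @ [c])"
    using rotate_append[of "take m (word t) @ [True, False]" "drop m (word t) @ [c]"] t' by simp
  finally show ?thesis by (simp only: rotate_rotate) blast
qed

text \<open>Existence half of the cycle lemma. Read cyclically, a string with both bits has a one
  directly followed by a zero; the two are removed, and put back by
  \<open>rotation_insert\<close>.\<close>

lemma rotation_of_word:
  assumes "length xs = 2 * n + 1" "ones xs = n + of_bool c"
  shows "\<exists>t k. size t = n \<and> xs = rotate k (word t @ [c])"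
  using assms
proof (induction n arbitrary: xs)
  case 0
  then obtain b where "xs = [b]" by (auto simp: length_Suc_conv)
  with 0 have "xs = rotate 0 (word Eps @ [c])" by (cases b; cases c) (auto simp: ones_Cons)
  then show ?case by (metis dyck.size(3))
next
  case (Suc n)
  have "True \<in> set xs"
  proof (rule ccontr)
    assume "True \<notin> set xs"
    then have "filter id xs = []" by (auto simp: filter_empty_conv)
    then show False using Suc(3) by (simp add: ones_def)
  qed
  then obtain as bs where xs: "xs = as @ True # bs" by (meson split_list)
  define ys where "ys = True # bs @ as"
  have "False \<in> set ys"
  proof (rule ccontr)
    assume "False \<notin> set ys"
    then have "\<forall>x \<in> set xs. id x" unfolding xs ys_def by auto (metis (full_types))+
    then have "ones xs = length xs" by (simp add: ones_def)
    then show False using Suc(2,3) by (cases c) simp_all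
  qed
  then obtain ps qs where ys: "ys = ps @ False # qs" "False \<notin> set ps" by (meson split_list_first)
  then obtain ps' where "ps = ps' @ [True]"
    by (cases ps rule: rev_cases) (auto simp: ys_def)
  with ys have ys': "ys = ps' @ [True, False] @ qs" by simp
  have x: "xs = rotate (length (True # bs)) ys"
    unfolding xs ys_def using rotate_append[of "True # bs" as] by simp
  then have "length ys = length xs" "ones ys = ones xs" by (metis length_rotate, metis ones_rotate)
  then have "length (ps' @ qs) = 2 * n + 1" "ones (ps' @ qs) = n + of_bool c"
    using Suc(2,3) ys' by simp_all
  then obtain t k where "ps' @ qs = rotate k (word t @ [c])" using Suc(1) by blast
  then obtain t' j where "ys = rotate j (word t' @ [c])" unfolding ys' using rotation_insert by blast
  with x have *: "xs = rotate (length (True # bs) + j) (word t' @ [c])" by (simp only: rotate_rotate)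
  then have "length xs = 2 * size t' + 1" by simp
  then have "size t' = Suc n" using Suc(2) by simp
  then show ?case using * by blast
qed

text \<open>Uniqueness half of the cycle lemma. A nontrivial rotation yields Dyck words
  \<open>p' c q\<close> and \<open>q c p'\<close>. No prefix has fewer ones than zeros; applied to
  \<open>p'\<close> and \<open>q\<close> if \<open>c\<close> is 1, and to \<open>p' c\<close> and
  \<open>q c\<close> if \<open>c\<close> is 0, this gives \<open>p' c q\<close> an excess of
  ones.\<close>

lemma rotation_of_word_trivial:
  assumes "rotate k (word s @ [c]) = word t @ [c]" "k < 2 * size s + 1"
  shows "k = 0"
proof (rule ccontr)
  assume k: "k \<noteq> 0"
  define p q where "p = take k (word s)" and "q = drop k (word s)"
  have ws: "word s = p @ q" by (simp add: p_def q_def)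
  have "rotate k (word s @ [c]) = drop k (word s @ [c]) @ take k (word s @ [c])"
    using assms(2) by (simp add: rotate_drop_take)
  then have wt: "word t @ [c] = q @ [c] @ p" using assms by (simp add: p_def q_def)
  have "length p = k" using assms(2) by (simp add: p_def)
  with k have "p \<noteq> []" by auto
  with wt obtain p' where p': "p = p' @ [c]" by (cases p rule: rev_cases) auto
  with wt have wt': "word t = q @ c # p'" by simp
  have ws': "word s = p' @ c # q" using ws p' by simp
  have "length (word s) = 2 * ones (word s)" by simp
  then have sum: "length p' + length q + 1 = 2 * (ones p' + ones q + of_bool c)"
    unfolding ws' by (simp add: ones_Cons)
  have "length p' \<le> 2 * ones p'" "length q \<le> 2 * ones q"
    using ones_prefix[OF ws'] ones_prefix[OF wt'] by auto
  moreover have "length p' + 1 \<le> 2 * ones p' + 2 * of_bool c" "length q + 1 \<le> 2 * ones q + 2 * of_bool c"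
    using ones_prefix[of s "p' @ [c]" q] ones_prefix[of t "q @ [c]" p'] ws' wt' by (auto simp: ones_Cons)
  ultimately show False using sum by (cases c) auto
qed

lemma rotation_of_word_inject:
  assumes "rotate i (word s @ [c]) = rotate j (word t @ [d])"
  shows "c = d \<and> s = t \<and> i mod (2 * size t + 1) = j mod (2 * size t + 1)"
proof -
  have "length (rotate i (word s @ [c])) = length (rotate j (word t @ [d]))"
    "ones (rotate i (word s @ [c])) = ones (rotate j (word t @ [d]))"
    using assms by simp_all
  then have sz: "size s = size t" and c: "c = d" by (cases c; cases d; auto simp: ones_Cons)+
  define N where "N = 2 * size t + 1"
  \<comment> \<open>Rotating by \<open>m\<close> undoes the rotation by \<open>j\<close>.\<close>
  define m where "m = N - j mod N"
  have N: "length (word s @ [c]) = N" "length (word t @ [d]) = N" using sz by (simp_all add: N_def)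
  have jm: "(m + j) mod N = 0"
  proof -
    have "j mod N < N" by (simp add: N_def)
    then have "m + j = N + N * (j div N)"
      unfolding m_def using mult_div_mod_eq[of N j] by linarith
    then show ?thesis by simp
  qed
  have "rotate (m + i) (word s @ [c]) = rotate (m + j) (word t @ [d])"
    using assms by (simp flip: rotate_rotate)
  also have "\<dots> = word t @ [c]" using jm N c by (subst rotate_conv_mod) simp
  finally have "rotate ((m + i) mod N) (word s @ [c]) = word t @ [c]"
    using N by (metis rotate_conv_mod)
  moreover from this have "(m + i) mod N = 0"
    by (rule rotation_of_word_trivial) (simp add: N_def sz)
  moreover from calculation have "s = t" by (auto intro: word_inject)
  moreover have "i mod N = j mod N"
  proof -
    have "(m + i) mod N = (m + j) mod N" using jm calculation by simp
    then show ?thesis by (simp add: mod_eq_dvd_iff_nat nat_mod_eq_iff)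
  qed
  ultimately show ?thesis using c by (simp add: N_def)
qed

section \<open>The cycle factor\<close>

text \<open>
  One turn of the Dyck word moves the bitstring by one position to the right, that is, by \<open>2n\<close>
  positions to the left modulo \<open>2n + 1\<close>.
\<close>

definition vertex :: "dyck \<Rightarrow> bool \<Rightarrow> nat \<Rightarrow> bool list" where
  "vertex t c j = rotate (2 * size t * j) (word t @ [c])"

text \<open>The string with last bit 1 between turns \<open>i - 1\<close> and \<open>i\<close> is
  counted with turn \<open>i\<close>, hence the rounding up: turn \<open>i\<close> has the indices
  \<open>2 * i - 1\<close> and \<open>2 * i\<close>.\<close>

definition vseq :: "dyck \<Rightarrow> nat \<Rightarrow> bool list" where
  "vseq t k = vertex ((rot ^^ ((k + 1) div 2)) t) (odd k) ((k + 1) div 2)"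

text \<open>As \<open>2 * n\<close> is -1 modulo \<open>2 * n + 1\<close>, its square is 1.
  Multiplication by \<open>2 * n\<close> thus converts turns to positions and back.\<close>

lemma double_mod: "(2 * n * (2 * n * j)) mod (2 * n + 1) = j mod (2 * n + 1 :: nat)"
proof (cases n)
  case (Suc m)
  then have "2 * n * (2 * n * j) = j + (2 * n + 1) * ((2 * m + 1) * j)" by (simp add: algebra_simps)
  then show ?thesis by (metis mod_mult_self2)
qed simp

lemma vertex_cong:
  assumes "i mod (2 * size t + 1) = j mod (2 * size t + 1)"
  shows "vertex t c i = vertex t c j"
proof -
  have "(2 * size t * i) mod (2 * size t + 1) = (2 * size t * j) mod (2 * size t + 1)"
    using assms by (metis mod_mult_right_eq)
  then show ?thesis unfolding vertex_def
    by (metis rotate_conv_mod length_append_singleton length_word Suc_eq_plus1)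
qed

lemma vertex_inject:
  assumes "vertex s c i = vertex t d j"
  shows "c = d \<and> s = t \<and> i mod (2 * size t + 1) = j mod (2 * size t + 1)"
proof -
  have *: "c = d \<and> s = t \<and> (2 * size s * i) mod (2 * size t + 1) = (2 * size t * j) mod (2 * size t + 1)"
    using rotation_of_word_inject assms unfolding vertex_def by blast
  then have "(2 * size t * (2 * size t * i)) mod (2 * size t + 1)
      = (2 * size t * (2 * size t * j)) mod (2 * size t + 1)"
    by (metis mod_mult_right_eq)
  then show ?thesis using * unfolding double_mod by blast
qed

lemma rotate_eq_vertex: "rotate k (word t @ [c]) = vertex t c (2 * size t * k)"
  unfolding vertex_def
  by (metis double_mod rotate_conv_mod length_append_singleton length_word Suc_eq_plus1)

section \<open>Periods of the vertex sequences\<close>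

lemma vseq_shift:
  assumes "2 * size t + 1 dvd m"
  shows "vseq t (2 * m + k) = vseq ((rot ^^ m) t) k"
proof -
  have "(2 * m + k + 1) div 2 = (k + 1) div 2 + m" by simp
  moreover have "((k + 1) div 2 + m) mod (2 * size t + 1) = ((k + 1) div 2) mod (2 * size t + 1)"
    using assms by (metis dvd_div_mult_self mod_mult_self1)
  ultimately show ?thesis
    unfolding vseq_def by (auto simp: funpow_add intro!: vertex_cong)
qed

text \<open>Word and position must both recur; the divisibility says that the position does.\<close>

definition is_period :: "dyck \<Rightarrow> nat \<Rightarrow> bool" where
  "is_period t m \<longleftrightarrow> 0 < m \<and> (rot ^^ m) t = t \<and> 2 * size t + 1 dvd m"

definition period :: "dyck \<Rightarrow> nat" where
  "period t = (LEAST m. is_period t m)"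

lemma is_period_period: "0 < size t \<Longrightarrow> is_period t (period t)"
  unfolding period_def
  by (rule LeastI[of _ "2 * size t * (2 * size t + 1)"])
    (simp add: is_period_def rot_pow_multiple del: mult_Suc_right)

lemma period_ge: "0 < size t \<Longrightarrow> 2 * size t + 1 \<le> period t"
  using is_period_period[of t] by (auto simp: is_period_def dest: dvd_imp_le)

lemma vseq_period:
  assumes "0 < size t"
  shows "vseq t (2 * period t * q + k) = vseq t k"
proof -
  have "(rot ^^ (period t * q)) t = t"
    using is_period_period[OF assms] by (induction q) (auto simp: funpow_add is_period_def)
  then show ?thesis
    using vseq_shift[of t "period t * q" k] is_period_period[OF assms]
    by (simp add: is_period_def mult.assoc)
qed

lemma vseq_inj:
  assumes "0 < size t"
  shows "inj_on (vseq t) {..<2 * period t}"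
proof (rule linorder_inj_onI)
  fix k l assume kl: "k < l" "k \<in> {..<2 * period t}" "l \<in> {..<2 * period t}"
  show "vseq t k \<noteq> vseq t l"
  proof
    assume "vseq t k = vseq t l"
    from vertex_inject[OF this[unfolded vseq_def]]
    have *: "odd k = odd l" "(rot ^^ ((k + 1) div 2)) t = (rot ^^ ((l + 1) div 2)) t"
       "(k + 1) div 2 mod (2 * size t + 1) = (l + 1) div 2 mod (2 * size t + 1)" by auto
    define d where "d = (l - k) div 2"
    from *(1) kl have l: "l = k + 2 * d" "0 < d" "d < period t" unfolding d_def by (auto; presburger)+
    then have h: "(l + 1) div 2 = (k + 1) div 2 + d" by simp
    have "(rot ^^ ((k + 1) div 2)) ((rot ^^ d) t) = (rot ^^ ((k + 1) div 2)) t"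
      using *(2) unfolding h by (simp add: funpow_add)
    then have "(rot ^^ d) t = t" by (rule rot_pow_cancel)
    moreover have "2 * size t + 1 dvd d"
      using *(3)[symmetric] mod_eq_dvd_iff_nat[of "(k + 1) div 2" "(k + 1) div 2 + d"] unfolding h by simp
    ultimately have "is_period t d" using l by (simp add: is_period_def)
    then have "period t \<le> d" unfolding period_def by (rule Least_le)
    then show False using l by simp
  qed
qed linarith

definition vertices :: "dyck set \<Rightarrow> bool list set" where
  "vertices S = {vertex t c j |t c j. t \<in> S}"

lemma vertices_Un: "vertices (S \<union> T) = vertices S \<union> vertices T"
  by (auto simp: vertices_def)

definition rot_orbit :: "dyck \<Rightarrow> dyck set" where
  "rot_orbit t = range (\<lambda>i. (rot ^^ i) t)"

text \<open>The word depends on the number of turns modulo \<open>2 * size t\<close>, the position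
  on it modulo \<open>2 * size t + 1\<close>. These moduli are coprime, so both can be
  prescribed.\<close>

lemma orbit_reachable:
  assumes "0 < size t" "s \<in> rot_orbit t"
  shows "\<exists>k > 0. (rot ^^ k) t = s \<and> k mod (2 * size t + 1) = j mod (2 * size t + 1)"
proof -
  obtain i where i: "s = (rot ^^ i) t" using assms(2) by (auto simp: rot_orbit_def)
  define n where "n = size t"
  \<comment> \<open>Adding a multiple of \<open>2 * n\<close> keeps the word. Modulo
    \<open>2 * n + 1\<close> the factor \<open>2 * n\<close> is -1, so \<open>k\<close> is
    \<open>i - (i - j)\<close>. The summand \<open>2 * n + 1\<close> makes \<open>k\<close>
    positive.\<close>
  define k where "k = i + 2 * n * (i + 2 * n * j + (2 * n + 1))"
  have "(rot ^^ k) t = s" unfolding k_def i n_def by (simp only: funpow_add o_apply rot_pow_multiple)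
  moreover have "k mod (2 * n + 1) = j mod (2 * n + 1)"
  proof -
    have "k = 2 * n * (2 * n * j) + (2 * n + 1) * (i + 2 * n)" by (simp add: k_def algebra_simps)
    then show ?thesis using double_mod[of n j] by (metis mod_mult_self2)
  qed
  moreover have "0 < k" using assms(1) by (simp add: k_def n_def)
  ultimately show ?thesis unfolding n_def by blast
qed

lemma vseq_image:
  assumes "0 < size t"
  shows "vseq t ` {..<2 * period t} = vertices (rot_orbit t)"
proof
  show "vseq t ` {..<2 * period t} \<subseteq> vertices (rot_orbit t)"
    by (auto simp: vseq_def vertices_def rot_orbit_def)
  show "vertices (rot_orbit t) \<subseteq> vseq t ` {..<2 * period t}"
  proof
    fix x assume "x \<in> vertices (rot_orbit t)"
    then obtain s c j where x: "x = vertex s c j" "s \<in> rot_orbit t" by (auto simp: vertices_def)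
    obtain k where k: "0 < k" "(rot ^^ k) t = s" "k mod (2 * size t + 1) = j mod (2 * size t + 1)"
      using orbit_reachable[OF assms x(2)] by blast
    \<comment> \<open>The index with turn \<open>k\<close> and last bit \<open>c\<close>; since
      \<open>k > 0\<close>, the subtraction is exact.\<close>
    define l where "l = 2 * k - of_bool c"
    have "(l + 1) div 2 = k" "odd l = c" using k(1) by (cases c; auto simp: l_def)+
    then have "vseq t l = vertex s c k" using k by (simp add: vseq_def)
    also have "\<dots> = x" unfolding x using k by (intro vertex_cong) auto
    finally have "x = vseq t (2 * period t * (l div (2 * period t)) + l mod (2 * period t))" by simp
    then have "x = vseq t (l mod (2 * period t))" using vseq_period[OF assms] by metis
    moreover have "l mod (2 * period t) < 2 * period t" using period_ge[OF assms] by simp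
    ultimately show "x \<in> vseq t ` {..<2 * period t}" by blast
  qed
qed

text \<open>The second string is \<open>1 a 1 b 0\<close>, that is, \<open>a 1 b 0\<close> followed
  by 1 and shifted one position to the right.\<close>

lemma flip_rot:
  assumes "0 < size t"
  shows "flip (word t @ [False]) (rotate (2 * size t) (word (rot t) @ [True]))"
proof -
  obtain a b where t: "t = Arch a b" using assms by (cases t) auto
  have "rotate (2 * size t) (word (rot t) @ [True]) = True # word (rot t)"
    using rotate_append[of "word (rot t)" "[True]"] by simp
  then show ?thesis
    using flipI[of True False "True # word a" "word b @ [False]"] by (simp add: t)
qed

lemma flip_vseq:
  assumes "0 < size t"
  shows "flip (vseq t k) (vseq t (Suc k))"
proof (cases "even k")
  case True
  define m where "m = k div 2"
  have k: "(k + 1) div 2 = m" "(Suc k + 1) div 2 = Suc m" using True by (auto simp: m_def)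
  have "flip (word ((rot ^^ m) t) @ [False]) (rotate (2 * size t) (word ((rot ^^ Suc m) t) @ [True]))"
    using flip_rot[of "(rot ^^ m) t"] assms by simp
  from flip_rotate[OF this, of "2 * size t * m"] show ?thesis
    using True unfolding vseq_def vertex_def k by (simp add: rotate_rotate algebra_simps)
next
  case False
  then have "(Suc k + 1) div 2 = (k + 1) div 2" by presburger
  then show ?thesis
    using False unfolding vseq_def vertex_def
    by (auto intro!: flip_rotate flipI[where q = "[]"])
qed

lemma vseq_0: "vseq t 0 = word t @ [False]"
  by (simp add: vseq_def vertex_def)

lemma vseq_1: "vseq t 1 = True # word (rot t)"
  using rotate_append[of "word (rot t)" "[True]"] by (simp add: vseq_def vertex_def)

section \<open>Gluing the cycles\<close>

text \<open>The other three edges of the 6-cycle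
  \<open>x\<^sub>0 x\<^sub>1 x\<^sub>6 x\<^sub>5 y\<^sub>0 y\<^sub>1\<close>, whose vertices differ
  only in the second bit, the third bit and the bit after \<open>u\<close>.\<close>

lemma gluing_flips:
  fixes u v
  defines "x \<equiv> Arch (Arch Eps u) v" and "y \<equiv> Arch Eps (Arch u v)"
  shows "flip (vseq x 1) (vseq x 6)" "flip (vseq y 0) (vseq x 5)" "flip (vseq x 0) (vseq y 1)"
proof -
  define n where "n = size x"
  define z where "z = word u @ True # word v @ [False]"
  have rot3: "(rot ^^ 3) x = cat u (Arch v (Arch Eps Eps))" by (simp add: x_def numeral_3_eq_3)
  \<comment> \<open>Since 6n = (2n - 2) + 2(2n + 1), three turns rotate by \<open>length z\<close>
    up to two complete rotations, which brings the last three bits to the front.\<close>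
  have "2 * n * 3 = length z + length (z @ [a, b, c]) * 2" for a b c
    by (simp add: n_def z_def x_def)
  then have rotz: "rotate (2 * n * 3) (z @ [a, b, c]) = [a, b, c] @ z" for a b c
    by (metis rotate_append rotate_conv_mod mod_mult_self2)
  have "vseq x 5 = rotate (2 * n * 3) (word ((rot ^^ 3) x) @ [True])"
    "vseq x 6 = rotate (2 * n * 3) (word ((rot ^^ 3) x) @ [False])"
    by (simp_all add: vseq_def vertex_def n_def del: mult_numeral_left)
  then have "vseq x 5 = [True, False, True] @ z" "vseq x 6 = [True, False, False] @ z"
    using rotz[of True False True] rotz[of True False False] unfolding rot3
    by (simp_all add: z_def)
  then show "flip (vseq x 1) (vseq x 6)" "flip (vseq y 0) (vseq x 5)" "flip (vseq x 0) (vseq y 1)"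
    using flipI[of False True "[True]" "False # z"]
      flipI[of True False "True # False # True # word u" "word v @ [False]"]
      flipI[of True False "[True, True]" "word u @ False # word v @ [False]"]
    by (simp_all add: vseq_0 vseq_1 x_def y_def z_def del: One_nat_def)
qed

section \<open>Orbits of the rotation\<close>

lemma orbit_self: "t \<in> rot_orbit t"
  unfolding rot_orbit_def by (rule range_eqI[of _ _ 0]) simp

lemma orbit_rot_pow: "(rot ^^ i) t \<in> rot_orbit t"
  by (auto simp: rot_orbit_def)

lemma orbit_sym: "s \<in> rot_orbit t \<Longrightarrow> t \<in> rot_orbit s"
proof -
  assume "s \<in> rot_orbit t"
  then obtain i where "s = (rot ^^ i) t" by (auto simp: rot_orbit_def)
  then have "t = (rot ^^ (2 * size t * i - i)) s" by (simp only: rot_pow_inverse)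
  then show ?thesis unfolding rot_orbit_def by (rule range_eqI)
qed

lemma orbit_trans:
  assumes "r \<in> rot_orbit s" "s \<in> rot_orbit t"
  shows "r \<in> rot_orbit t"
proof -
  obtain i j where "r = (rot ^^ i) s" "s = (rot ^^ j) t" using assms by (auto simp: rot_orbit_def)
  then have "r = (rot ^^ (i + j)) t" by (simp add: funpow_add)
  then show ?thesis by (simp add: orbit_rot_pow)
qed

lemma size_orbit: "s \<in> rot_orbit t \<Longrightarrow> size s = size t"
  by (auto simp: rot_orbit_def)

text \<open>Position 0 in \<open>orbit_reachable\<close> puts the edge at an even index. In
  \<open>spans_glue\<close>, evenness separates it from the removed edge
  \<open>x\<^sub>5 x\<^sub>6\<close>, and the last conjunct from
  \<open>x\<^sub>0 x\<^sub>1\<close>.\<close>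

lemma orbit_arc:
  assumes "0 < size t" "s \<in> rot_orbit t"
  shows "\<exists>k < period t. vseq t (2 * k) = vseq s 0 \<and> vseq t (Suc (2 * k)) = vseq s 1 \<and> (k = 0 \<longrightarrow> s = t)"
proof -
  obtain k where k: "(rot ^^ k) t = s" "k mod (2 * size t + 1) = 0"
    using orbit_reachable[OF assms, of 0] by auto
  define q r where "q = k div period t" and "r = k mod period t"
  then have kq: "k = period t * q + r" by simp
  have "vseq t (2 * r + i) = vseq s i" for i
  proof -
    have "2 * k + i = 2 * period t * q + (2 * r + i)" unfolding kq by (simp add: algebra_simps)
    then have "vseq t (2 * r + i) = vseq t (2 * k + i)" by (simp only: vseq_period[OF assms(1)])
    also have "\<dots> = vseq s i" using vseq_shift[of t k i] k by (simp add: mod_eq_0_iff_dvd)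
    finally show ?thesis .
  qed
  from this[of 0] this[of 1] have *: "vseq t (2 * r) = vseq s 0" "vseq t (Suc (2 * r)) = vseq s 1" by simp_all
  moreover have "r < period t" using period_ge[OF assms(1)] by (simp add: r_def)
  moreover have "r = 0 \<longrightarrow> s = t" using *(1) by (auto simp: vseq_0 dest: word_inject)
  ultimately show ?thesis by blast
qed

section \<open>Paths covering unions of orbits\<close>

definition flips :: "(bool list \<times> bool list) set" where
  "flips = {(x, y). flip x y}"

lemma sym_flips: "sym flips"
  by (rule symI) (simp add: flips_def flip_sym)

text \<open>
  The last clause keeps the edges available that are needed for the cycles still to be merged in.
  They are never the closing edge of the list, so it suffices to splice lists in the interior.
\<close>

definition spans :: "dyck set \<Rightarrow> bool list list \<Rightarrow> bool" where
  "spans S xs \<longleftrightarrow> distinct xs \<and> set xs = vertices S \<and> links xs \<subseteq> flips \<and>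
    flip (last xs) (hd xs) \<and> xs \<noteq> [] \<and>
    (\<forall>u v. Arch Eps (Arch u v) \<in> S \<longrightarrow> Arch (Arch Eps u) v \<notin> S \<longrightarrow>
      (vseq (Arch Eps (Arch u v)) 0, vseq (Arch Eps (Arch u v)) 1) \<in> links xs)"

lemma links_subset_flips: "set (steps xs) \<subseteq> flips \<Longrightarrow> links xs \<subseteq> flips"
  using symD[OF sym_flips] unfolding links_def by blast

lemma spans_orbit:
  assumes "0 < size t"
  shows "spans (rot_orbit t) (map (vseq t) [0..<2 * period t])"
proof -
  define L where "L = period t"
  have L: "0 < L" using period_ge[OF assms] by (simp add: L_def)
  define xs where "xs = map (vseq t) [0..<2 * L]"
  have "distinct xs" using vseq_inj[OF assms] by (simp add: xs_def L_def distinct_map lessThan_atLeast0)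
  moreover have "set xs = vertices (rot_orbit t)"
    using vseq_image[OF assms] by (simp add: xs_def L_def lessThan_atLeast0)
  moreover have "links xs \<subseteq> flips"
    by (rule links_subset_flips) (auto simp: xs_def steps_map_upt flips_def flip_vseq assms)
  moreover have "flip (last xs) (hd xs)"
  proof -
    have "last xs = vseq t (2 * L - 1)" "hd xs = vseq t 0" using L by (simp_all add: xs_def last_map hd_map)
    moreover have "vseq t 0 = vseq t (Suc (2 * L - 1))"
      using vseq_period[OF assms, of 1 0] L by (simp add: L_def)
    ultimately show ?thesis using flip_vseq[OF assms, of "2 * L - 1"] by simp
  qed
  moreover have "(vseq s 0, vseq s 1) \<in> links xs" if "s \<in> rot_orbit t" for s
  proof -
    obtain k where "k < L" "vseq t (2 * k) = vseq s 0" "vseq t (Suc (2 * k)) = vseq s 1"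
      using orbit_arc[OF assms \<open>s \<in> rot_orbit t\<close>] unfolding L_def by blast
    moreover from this(1) have "(vseq t (2 * k), vseq t (Suc (2 * k))) \<in> set (steps xs)"
      unfolding xs_def steps_map_upt by (intro imageI) simp
    ultimately show ?thesis by (simp add: links_def)
  qed
  ultimately show ?thesis using L by (auto simp: spans_def xs_def L_def)
qed

lemma spans_glue:
  fixes u v
  defines "x \<equiv> Arch (Arch Eps u) v" and "y \<equiv> Arch Eps (Arch u v)"
  assumes spans: "spans S xs" and closed: "\<And>t. t \<in> S \<Longrightarrow> rot_orbit t \<subseteq> S" and x: "x \<notin> S" and y: "y \<in> S"
  shows "\<exists>ys. spans (S \<union> rot_orbit x) ys"
proof -
  have sx: "0 < size x" by (simp add: x_def)
  define L where "L = period x"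
  have "2 * size x + 1 \<le> L" unfolding L_def by (rule period_ge[OF sx])
  then have L: "5 \<le> L" by (simp add: x_def)
  \<comment> \<open>The path omits the edges \<open>x\<^sub>0 x\<^sub>1\<close> and
    \<open>x\<^sub>5 x\<^sub>6\<close> and uses the new edge \<open>x\<^sub>1 x\<^sub>6\<close>. It
    leads from \<open>x\<^sub>5\<close>, a neighbour of \<open>y\<^sub>0\<close>, to
    \<open>x\<^sub>0\<close>, a neighbour of \<open>y\<^sub>1\<close>.\<close>
  define ks where "ks = rev [1..<6] @ [6..<2 * L] @ [0]"
  define ps where "ps = map (vseq x) ks"
  have ks: "distinct ks" "set ks = {..<2 * L}" using L by (auto simp: ks_def)
  have "ps \<noteq> []" by (simp add: ps_def ks_def)
  moreover have "distinct ps" "set ps = vertices (rot_orbit x)"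
    using vseq_inj[OF sx] vseq_image[OF sx] ks by (simp_all add: ps_def distinct_map L_def)
  ultimately have dps: "distinct ps" "set ps = vertices (rot_orbit x)" "ps \<noteq> []" by blast+
  have hps: "hd ps = vseq x 5" "last ps = vseq x 0"
    by (simp_all add: ps_def ks_def eval_nat_numeral)
  have steps: "set (steps ps) = {(vseq x 1, vseq x 6), (vseq x (2 * L - 1), vseq x 0)} \<union>
      (set (steps (map (vseq x) [1..<6])))\<inverse> \<union> set (steps (map (vseq x) [6..<2 * L]))"
  proof -
    have ne: "[1..<6::nat] \<noteq> []" "[6..<2 * L] \<noteq> []" using L by simp_all
    have "ps = rev (map (vseq x) [1..<6]) @ map (vseq x) [6..<2 * L] @ [vseq x 0]"
      by (simp add: ps_def ks_def rev_map)
    moreover have "last (rev (map (vseq x) [1..<6])) = vseq x 1"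
      using ne by (simp add: last_rev hd_map)
    moreover have "hd (map (vseq x) [6..<2 * L] @ [vseq x 0]) = vseq x 6"
      using ne by (simp add: hd_map hd_append)
    moreover have "last (map (vseq x) [6..<2 * L]) = vseq x (2 * L - 1)"
      using ne by (simp add: last_map)
    ultimately show ?thesis
      using ne by (simp add: steps_join steps_rev del: upt_rec_numeral)
  qed
  note glue = gluing_flips[of u v, folded x_def y_def]
  have "links ps \<subseteq> flips"
  proof (rule links_subset_flips)
    have "vseq x 0 = vseq x (Suc (2 * L - 1))" using vseq_period[OF sx, of 1 0] L by (simp add: L_def)
    then have "flip (vseq x (2 * L - 1)) (vseq x 0)" using flip_vseq[OF sx] by metis
    then show "set (steps ps) \<subseteq> flips"
      using glue(1) flip_vseq[OF sx] flip_sym[OF flip_vseq[OF sx]] unfolding steps steps_map_upt flips_def by auto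
  qed
  moreover have "(vseq y 0, hd ps) \<in> flips" "(last ps, vseq y 1) \<in> flips"
    using glue hps by (simp_all add: flips_def)
  moreover have "set xs \<inter> set ps = {}"
  proof -
    have False if "t \<in> S" "t \<in> rot_orbit x" for t using that closed orbit_sym x by blast
    moreover have "set xs = vertices S" using spans by (simp add: spans_def)
    ultimately show ?thesis unfolding dps(2) by (auto simp: vertices_def dest!: vertex_inject)
  qed
  moreover have yl: "(vseq y 0, vseq y 1) \<in> links xs"
    using spans x y unfolding spans_def x_def y_def by blast
  moreover have "distinct xs" "links xs \<subseteq> flips" using spans by (simp_all add: spans_def)
  ultimately obtain ys where ys: "distinct ys" "set ys = set xs \<union> set ps" "hd ys = hd xs" "last ys = last xs"
     "links ys \<subseteq> flips" and
     sub: "links xs - {(vseq y 0, vseq y 1), (vseq y 1, vseq y 0)} \<union> links ps \<subseteq> links ys"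
    using splice[OF _ _ dps(1) _ dps(3) Un_least sym_flips, of "vseq y 0" "vseq y 1" xs] by blast
  have "set ys = vertices (S \<union> rot_orbit x)"
    using ys(2) dps(2) spans by (simp add: spans_def vertices_Un)
  moreover have "ys \<noteq> []" using ys(2) dps(3) by auto
  moreover have "(vseq y' 0, vseq y' 1) \<in> links ys"
    if y': "y' = Arch Eps (Arch u' v')" "y' \<in> S \<union> rot_orbit x" "Arch (Arch Eps u') v' \<notin> S \<union> rot_orbit x" for y' u' v'
  proof (cases "y' \<in> S")
    case True
    then have "(vseq y' 0, vseq y' 1) \<in> links xs" using y' spans by (simp add: spans_def)
    \<comment> \<open>Only the edge \<open>y\<^sub>0 y\<^sub>1\<close> is lost. The partner
      \<open>x\<close> of \<open>y\<close> is now covered, so \<open>y'\<close> differs from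
      \<open>y\<close>.\<close>
    moreover have "y' \<noteq> y" using y'(1,3) orbit_self[of x] by (auto simp: x_def y_def)
    then have "vseq y' 0 \<noteq> vseq y 0" by (auto simp: vseq_0 dest: word_inject)
    moreover have "vseq y' 0 \<noteq> vseq y 1" by (auto simp: vseq_def dest: vertex_inject)
    ultimately show ?thesis using sub by blast
  next
    case False
    with y' have "y' \<in> rot_orbit x" by simp
    from orbit_arc[OF sx this] obtain k where k: "k < L" "vseq x (2 * k) = vseq y' 0"
      "vseq x (Suc (2 * k)) = vseq y' 1" "k = 0 \<longrightarrow> y' = x" unfolding L_def by blast
    then have "k \<noteq> 0" using y'(1) by (auto simp: x_def)
    \<comment> \<open>Being even, \<open>2 * k\<close> is not the index 5 of the removed
      edge.\<close>
    then have "2 * k \<in> {k. 1 \<le> k \<and> Suc k < 6} \<union> {k. 6 \<le> k \<and> Suc k < 2 * L}"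
      using k(1) by auto
    then have "(vseq x (2 * k), vseq x (Suc (2 * k))) \<in> links ps"
      unfolding links_def steps steps_map_upt by blast
    then show ?thesis using k sub by auto
  qed
  ultimately have "spans (S \<union> rot_orbit x) ys"
    using spans ys(1,3-5) unfolding spans_def by simp
  then show ?thesis by blast
qed

section \<open>Merging all orbits\<close>

lemma finite_dyck: "finite {t :: dyck. size t = n}"
proof (rule finite_imageD)
  show "finite (word ` {t. size t = n})"
    by (rule finite_subset[OF _ finite_lists_length_eq[OF finite_UNIV, of "2 * n"]]) auto
  show "inj_on word {t. size t = n}" by (auto intro: inj_onI word_inject)
qed

lemma spans_extend:
  assumes "S \<subseteq> {t. size t = n}" "star n \<in> S" "\<And>t. t \<in> S \<Longrightarrow> rot_orbit t \<subseteq> S" "spans S xs"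
  shows "\<exists>ys. spans {t. size t = n} ys"
  using assms
proof (induction "card ({t. size t = n} - S)" arbitrary: S xs rule: less_induct)
  case less
  show ?case
  proof (cases "S = {t. size t = n}")
    case False
    with less.prems(1) obtain t0 where t0: "size t0 = n \<and> t0 \<notin> S" by blast
    obtain t where t: "size t = n" "t \<notin> S"
      and min: "\<And>s. size s = n \<Longrightarrow> s \<notin> S \<Longrightarrow> area t \<le> area s"
      using ex_has_least_nat[of "\<lambda>t. size t = n \<and> t \<notin> S" t0 area, OF t0] by blast
    have "t \<noteq> star (size t)" using t less.prems(2) by auto
    with pull_leaf[of t] obtain t' where t': "size t' = size t" "area t' < area t"
      and ex: "\<And>e. \<exists>u v i j. (rot ^^ i) (cat t e) = Arch (Arch Eps u) v \<and>
        (rot ^^ j) (cat t' e) = Arch Eps (Arch u v)" by blast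
    obtain u v i j where xy: "(rot ^^ i) t = Arch (Arch Eps u) v" "(rot ^^ j) t' = Arch Eps (Arch u v)"
      using ex[of Eps] by auto
    define x where "x = Arch (Arch Eps u) v"
    \<comment> \<open>By the choice of \<open>t\<close>, the smaller area forces \<open>t'\<close>
      into \<open>S\<close>. Closure under orbits carries this to the rotation of \<open>t'\<close>,
      and keeps \<open>x\<close> outside together with \<open>t\<close>.\<close>
    have "t' \<in> S" using t' t min by (metis leD)
    then have "Arch Eps (Arch u v) \<in> S" using less.prems(3) orbit_rot_pow[of j t'] xy by auto
    moreover have xt: "x \<in> rot_orbit t" using orbit_rot_pow[of i t] xy by (simp add: x_def)
    then have "x \<notin> S" using less.prems(3) orbit_sym t(2) by blast
    ultimately obtain ys where ys: "spans (S \<union> rot_orbit x) ys"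
      using spans_glue[OF less.prems(4,3)] unfolding x_def by blast
    have size: "s \<in> rot_orbit x \<Longrightarrow> size s = n" for s using size_orbit xt t(1) by metis
    have "card ({t. size t = n} - (S \<union> rot_orbit x)) < card ({t. size t = n} - S)"
    proof (rule psubset_card_mono)
      show "{t. size t = n} - (S \<union> rot_orbit x) \<subset> {t. size t = n} - S"
        using \<open>x \<notin> S\<close> size orbit_self[of x] by blast
    qed (simp add: finite_dyck)
    moreover have "rot_orbit s \<subseteq> S \<union> rot_orbit x" if "s \<in> S \<union> rot_orbit x" for s
      using that less.prems(3) orbit_trans by blast
    ultimately show ?thesis
      using less.hyps[OF _ _ _ _ ys] less.prems(1,2) size by blast
  qed (use less.prems in blast)
qed

lemma verts_middle_layer_graph: "pverts (middle_layer_graph n) = vertices {t. size t = n}"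
proof -
  have bits: "bitstrings m k = {x. length x = m \<and> ones x = k}" for m k
    unfolding bitstrings_def ones_card by blast
  have "pverts (middle_layer_graph n) = {x. length x = 2 * n + 1 \<and> (\<exists>c. ones x = n + of_bool c)}"
    unfolding middle_layer_graph_def bits by (simp add: ex_bool_eq Let_def) blast
  also have "\<dots> = vertices {t. size t = n}"
  proof (intro set_eqI iffI)
    fix x assume "x \<in> {x. length x = 2 * n + 1 \<and> (\<exists>c. ones x = n + of_bool c)}"
    then obtain c where "length x = 2 * n + 1" "ones x = n + of_bool c" by blast
    then obtain t k where t: "size t = n" "x = rotate k (word t @ [c])" using rotation_of_word by blast
    show "x \<in> vertices {t. size t = n}"
      unfolding t(2) rotate_eq_vertex vertices_def using t(1) by blast
  next
    fix x assume "x \<in> vertices {t. size t = n}"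
    then obtain t c j where "size t = n" "x = vertex t c j" by (auto simp: vertices_def)
    then have "length x = 2 * n + 1" "ones x = n + of_bool c"
      by (simp_all add: vertex_def ones_Cons)
    then show "x \<in> {x. length x = 2 * n + 1 \<and> (\<exists>c. ones x = n + of_bool c)}" by blast
  qed
  finally show ?thesis .
qed

theorem theorem1:
  fixes n :: nat
  assumes "n \<ge> 1"
  shows "\<exists>p. pre_digraph.hamilton_cycle (with_proj (middle_layer_graph n)) p"
proof -
  define t where "t = star n"
  have t: "0 < size t" "size t = n" using assms by (simp_all add: t_def)
  have "rot_orbit t \<subseteq> {t. size t = n}" using size_orbit t by auto
  moreover have "rot_orbit s \<subseteq> rot_orbit t" if "s \<in> rot_orbit t" for s using that orbit_trans by blast
  ultimately obtain xs where xs: "spans {t. size t = n} xs"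
    using spans_extend[OF _ _ _ spans_orbit[OF t(1)], of n] orbit_self[of t] unfolding t_def by blast
  have parcs: "(x, y) \<in> parcs (middle_layer_graph n)"
    if "x \<in> set xs" "y \<in> set xs" "flip x y" for x y
  proof -
    have v: "x \<in> pverts (middle_layer_graph n)" "y \<in> pverts (middle_layer_graph n)"
      using that xs by (simp_all add: verts_middle_layer_graph spans_def)
    then have "length x = 2 * n + 1" by (auto simp: middle_layer_graph_def bitstrings_def)
    then show ?thesis using v flip_card[OF \<open>flip x y\<close>] by (simp add: middle_layer_graph_def Let_def)
  qed
  have "set (steps xs) \<subseteq> parcs (middle_layer_graph n)"
  proof safe
    fix x y assume "(x, y) \<in> set (steps xs)"
    moreover from this have "flip x y" using xs by (auto simp: spans_def links_def flips_def)
    ultimately show "(x, y) \<in> parcs (middle_layer_graph n)" using parcs steps_subset[of xs] by blast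
  qed
  moreover have "(last xs, hd xs) \<in> parcs (middle_layer_graph n)"
    using xs unfolding spans_def by (intro parcs) (metis last_in_set, metis hd_in_set, blast)
  moreover have "3 \<le> length xs"
  proof -
    \<comment> \<open>The cycle of the star alone already has at least six vertices.\<close>
    have "3 \<le> 2 * period t" using period_ge[OF t(1)] t by simp
    also have "\<dots> = card (vseq t ` {..<2 * period t})" by (simp add: card_image vseq_inj[OF t(1)])
    also have "\<dots> \<le> card (set xs)"
    proof (rule card_mono)
      show "vseq t ` {..<2 * period t} \<subseteq> set xs"
        using xs \<open>rot_orbit t \<subseteq> _\<close> unfolding vseq_image[OF t(1)]
        by (auto simp: spans_def vertices_def)
    qed simp
    also have "\<dots> \<le> length xs" by (rule card_length)
    finally show ?thesis .
  qed
  ultimately show ?thesis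
    using hamilton_cycle_steps[of xs "middle_layer_graph n"] xs verts_middle_layer_graph
    by (auto simp: spans_def)
qed

end
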